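(* Let $V$ be a discrete valuation ring with valuation $\nu$ and field of fractions $K$, let $n\ge1$, $\mathbf{m}\in\mathbb{W}^n$, $k\in\mathbb{W}$, and let $\underline{S}\subseteq V^n$ satisfy $I(\underline{S})=\{0\}$. Let $\{\underline{a}_i\}_{0\le i<l_{\mathbf{m}}}$ be a $\nu_{\mathbf{m}}$-ordering of $\underline{S}$. Then $$\nu(\Gamma_{\mathbf{m},k}(\underline{S}))=\max_{\substack{0\le r<l_{\mathbf{m},k}\\0\le s\le r}}\nu\left(\frac{\Delta_{\mathbf{m}}(\underline{a}_0,\dots,\underline{a}_r)}{\Delta_{\mathbf{m}}(s;\underline{a}_0,\dots,\underline{a}_{r-1})}\right),$$ where pairs $(r,s)$ with $\Delta_{\mathbf{m}}(s;\underline{a}_0,\dots,\underline{a}_{r-1})=0$ are disregarded.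
   Context: $\mathbb{W}$ is the set of non-negative integers; $\underline{x}=(x_1,\dots,x_n)$. $\deg(f)\in\mathbb{W}^n$ is the $n$-tuple of partial degrees of $f$, $\mathrm{tdeg}(f)$ its total degree; order on $\mathbb{W}^n$ is componentwise. $I(\underline{S})=\{f\in K[\underline{x}]:f(\underline{S})=0\}$. $\mathrm{Int}_{\mathbf{m},k}(\underline{S},V)=\{f\in K[\underline{x}]: f(\underline{S})\subseteq V,\ \deg(f)\le\mathbf{m},\ \mathrm{tdeg}(f)\le k\}$ (including $0$), and $\Gamma_{\mathbf{m},k}(\underline{S})=\{a\in V: a\,\mathrm{Int}_{\mathbf{m},k}(\underline{S},V)\subseteq V[\underline{x}]\}$. For a nonzero ideal $J$ of $V$, $\nu(J)$ is the valuation of a generator. Let $l_{\mathbf{m}}$ be the number of monomials (with coefficient 1) of degree $\le\mathbf{m}$, and $l_{\mathbf{m},k}$ the number of those that moreover have total degree $\le k$. Fix an enumeration $(p_j)_{0\le j<l_{\mathbf{m}}}$ of the monomials of degree $\le\mathbf{m}$ with $p_0=1$ and $\mathrm{tdeg}(p_i)\le\mathrm{tdeg}(p_j)$ for $i<j$. For $r<l_{\mathbf{m}}$ put $\Delta_{\mathbf{m}}(\underline{a}_0,\dots,\underline{a}_r)=\det(p_j(\underline{a}_i))_{0\le i,j\le r}$, and for $0\le s\le r$ put $\Delta_{\mathbf{m}}(s;\underline{a}_0,\dots,\underline{a}_{r-1})=\det(p_j(\underline{a}_i))_{0\le i<r,\ 0\le j\le r,\ j\ne s}$ (the empty determinant,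 for $r=0$, is $1$). A sequence $\{\underline{a}_i\}_{0\le i<l_{\mathbf{m}}}$ in $\underline{S}$ is a $\nu_{\mathbf{m}}$-ordering of $\underline{S}$ if for every $1\le r<l_{\mathbf{m}}$, $\nu(\Delta_{\mathbf{m}}(\underline{a}_0,\dots,\underline{a}_r))=\inf_{\underline{a}\in\underline{S}}\nu(\Delta_{\mathbf{m}}(\underline{a}_0,\dots,\underline{a}_{r-1},\underline{a}))$. When $I(\underline{S})=\{0\}$ these determinants are nonzero. *)

theory Defs
  imports "HOL-Library.Poly_Mapping" "HOL-Library.Extended_Real"
    "Jordan_Normal_Form.Determinant"
begin

text \<open>
  A discrete valuation ring is given as the valuation ring of a normalised discrete valuation
  on its field of fractions, which is the whole type \<open>'k\<close>. Values lie in the integers together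
  with \<open>\<infinity>\<close> (the value of 0), embedded in the complete lattice of extended reals so that infima
  over arbitrary sets are available.
\<close>

definition discrete_valuation :: "('k::field \<Rightarrow> ereal) \<Rightarrow> bool" where
  "discrete_valuation \<nu> \<longleftrightarrow>
     (\<forall>x. \<nu> x = \<infinity> \<longleftrightarrow> x = 0) \<and>
     \<nu> ` (UNIV - {0}) = range (\<lambda>z::int. ereal (of_int z)) \<and>
     (\<forall>x y. \<nu> (x * y) = \<nu> x + \<nu> y) \<and>
     (\<forall>x y. min (\<nu> x) (\<nu> y) \<le> \<nu> (x + y))"

definition val_ring :: "('k::field \<Rightarrow> ereal) \<Rightarrow> 'k set" where
  "val_ring \<nu> = {x. 0 \<le> \<nu> x}"

text \<open>
  The value of an ideal is the value of any of its generators; ideals of the valuation ring are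
  principal, and generators of the same ideal have the same value.
\<close>

definition ideal_val :: "('k::field \<Rightarrow> ereal) \<Rightarrow> 'k set \<Rightarrow> ereal" where
  "ideal_val \<nu> J = (THE e. \<exists>g\<in>J. J = {g * c | c. c \<in> val_ring \<nu>} \<and> \<nu> g = e)"

text \<open>
  The polynomial ring in variables indexed by the finite (hence nonempty) type \<open>'n\<close>: finitely
  supported maps from exponent vectors to coefficients, with the convolution product.
\<close>

type_synonym ('n, 'k) mpoly = "('n \<Rightarrow>\<^sub>0 nat) \<Rightarrow>\<^sub>0 'k"

definition eval :: "('n::finite, 'k::field) mpoly \<Rightarrow> ('n \<Rightarrow> 'k) \<Rightarrow> 'k" where
  "eval f x = (\<Sum>t\<in>Poly_Mapping.keys f.
      Poly_Mapping.lookup f t * (\<Prod>i\<in>UNIV. x i ^ Poly_Mapping.lookup t i))"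

text \<open>
  The degrees of the zero polynomial are set to 0, so that it satisfies every degree bound. The
  order used on tuples of partial degrees is the pointwise order on functions.
\<close>

definition pdeg :: "('n::finite, 'k::field) mpoly \<Rightarrow> 'n \<Rightarrow> nat" where
  "pdeg f = (\<lambda>i. Max (insert 0 ((\<lambda>t. Poly_Mapping.lookup t i) ` Poly_Mapping.keys f)))"

definition tdeg :: "('n::finite, 'k::field) mpoly \<Rightarrow> nat" where
  "tdeg f = Max (insert 0 ((\<lambda>t. \<Sum>i\<in>UNIV. Poly_Mapping.lookup t i) ` Poly_Mapping.keys f))"

definition vanishing_ideal :: "('n::finite \<Rightarrow> 'k::field) set \<Rightarrow> ('n, 'k) mpoly set" where
  "vanishing_ideal S = {f. \<forall>x\<in>S. eval f x = 0}"

definition Int_poly ::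
  "('k::field \<Rightarrow> ereal) \<Rightarrow> ('n::finite \<Rightarrow> nat) \<Rightarrow> nat \<Rightarrow> ('n \<Rightarrow> 'k) set \<Rightarrow> ('n, 'k) mpoly set" where
  "Int_poly \<nu> m k S = {f. eval f ` S \<subseteq> val_ring \<nu> \<and> pdeg f \<le> m \<and> tdeg f \<le> k}"

definition val_ring_polys :: "('k::field \<Rightarrow> ereal) \<Rightarrow> ('n::finite, 'k) mpoly set" where
  "val_ring_polys \<nu> = {f. \<forall>t. Poly_Mapping.lookup f t \<in> val_ring \<nu>}"

text \<open>Here \<open>Poly_Mapping.single 0 c\<close> is the constant polynomial \<open>c\<close>.\<close>

definition Gamma_ideal ::
  "('k::field \<Rightarrow> ereal) \<Rightarrow> ('n::finite \<Rightarrow> nat) \<Rightarrow> nat \<Rightarrow> ('n \<Rightarrow> 'k) set \<Rightarrow> 'k set" where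
  "Gamma_ideal \<nu> m k S =
     {c \<in> val_ring \<nu>. (\<lambda>f. Poly_Mapping.single 0 c * f) ` Int_poly \<nu> m k S \<subseteq> val_ring_polys \<nu>}"

definition monomials :: "('n::finite \<Rightarrow> nat) \<Rightarrow> ('n, 'k::field) mpoly set" where
  "monomials m = {q. (\<exists>t. q = Poly_Mapping.single t 1) \<and> pdeg q \<le> m}"

definition monomials_tdeg :: "('n::finite \<Rightarrow> nat) \<Rightarrow> nat \<Rightarrow> ('n, 'k::field) mpoly set" where
  "monomials_tdeg m k = {q \<in> monomials m. tdeg q \<le> k}"

definition monomial_enumeration ::
  "('n::finite \<Rightarrow> nat) \<Rightarrow> (nat \<Rightarrow> ('n, 'k::field) mpoly) \<Rightarrow> bool" where
  "monomial_enumeration m p \<longleftrightarrow>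
     bij_betw p {..<card (monomials m :: ('n, 'k) mpoly set)} (monomials m) \<and>
     p 0 = 1 \<and>
     (\<forall>i j. i < j \<longrightarrow> j < card (monomials m :: ('n, 'k) mpoly set) \<longrightarrow> tdeg (p i) \<le> tdeg (p j))"

text \<open>\<open>Delta p a r\<close> uses only the points \<open>a 0, \<dots>, a r\<close>.\<close>

definition Delta ::
  "(nat \<Rightarrow> ('n::finite, 'k::field) mpoly) \<Rightarrow> (nat \<Rightarrow> 'n \<Rightarrow> 'k) \<Rightarrow> nat \<Rightarrow> 'k" where
  "Delta p a r = det (mat (Suc r) (Suc r) (\<lambda>(i, j). eval (p j) (a i)))"

text \<open>
  \<open>Delta_minor p a s r\<close> uses the points \<open>a 0, \<dots>, a (r - 1)\<close> and the columns \<open>0, \<dots>, r\<close> with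
  column \<open>s\<close> left out; for \<open>r = 0\<close> it is the empty determinant, which is 1.
\<close>

definition Delta_minor ::
  "(nat \<Rightarrow> ('n::finite, 'k::field) mpoly) \<Rightarrow> (nat \<Rightarrow> 'n \<Rightarrow> 'k) \<Rightarrow> nat \<Rightarrow> nat \<Rightarrow> 'k" where
  "Delta_minor p a s r =
     det (mat r r (\<lambda>(i, j). eval (p (if j < s then j else Suc j)) (a i)))"

definition nu_ordering ::
  "('k::field \<Rightarrow> ereal) \<Rightarrow> ('n::finite \<Rightarrow> nat) \<Rightarrow> (nat \<Rightarrow> ('n, 'k) mpoly) \<Rightarrow>
   ('n \<Rightarrow> 'k) set \<Rightarrow> (nat \<Rightarrow> 'n \<Rightarrow> 'k) \<Rightarrow> bool" where
  "nu_ordering \<nu> m p S a \<longleftrightarrow>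
     (\<forall>i < card (monomials m :: ('n, 'k) mpoly set). a i \<in> S) \<and>
     (\<forall>r. 1 \<le> r \<and> r < card (monomials m :: ('n, 'k) mpoly set) \<longrightarrow>
        \<nu> (Delta p a r) = (INF x\<in>S. \<nu> (Delta p (a(r := x)) r)))"

end

theory Submission
  imports Defs
begin

text \<open>
  The polynomials \<open>F\<^sub>r(x) = \<Delta>(a\<^sub>0, \<dots>, a\<^sub>r\<^sub>-\<^sub>1, x) / \<Delta>(a\<^sub>0, \<dots>, a\<^sub>r)\<close> play the role of Newton's
  interpolation basis: \<open>F\<^sub>r\<close> vanishes at the points before \<open>a\<^sub>r\<close>, equals 1 at \<open>a\<^sub>r\<close>, and takes integral
  values on \<open>S\<close> because \<open>a\<close> is a \<open>\<nu>\<close>-ordering. Forward substitution therefore expands every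
  integer-valued polynomial in the \<open>F\<^sub>r\<close> with integral coefficients, so \<open>\<Gamma>\<close> consists of the common
  denominators of the coefficients of the \<open>F\<^sub>r\<close>. By Laplace expansion along the row of \<open>x\<close> these
  coefficients are, up to sign, the quotients of a minor by \<open>\<Delta>(a\<^sub>0, \<dots>, a\<^sub>r)\<close>.
\<close>

section \<open>Discrete valuations\<close>

lemma valuation_0 [simp]: "discrete_valuation \<nu> \<Longrightarrow> \<nu> 0 = \<infinity>"
  by (simp add: discrete_valuation_def)

lemma valuation_mult: "discrete_valuation \<nu> \<Longrightarrow> \<nu> (x * y) = \<nu> x + \<nu> y"
  by (simp add: discrete_valuation_def)

lemma valuation_finite:
  assumes "discrete_valuation \<nu>" "x \<noteq> 0"
  obtains v where "\<nu> x = ereal v"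
proof -
  have "\<nu> x \<in> range (\<lambda>z::int. ereal (of_int z))"
    using assms unfolding discrete_valuation_def by (metis DiffI UNIV_I imageI singletonD)
  then show thesis using that by auto
qed

lemma valuation_1:
  assumes "discrete_valuation \<nu>"
  shows "\<nu> 1 = 0"
proof -
  obtain v where v: "\<nu> 1 = ereal v" using valuation_finite[OF assms one_neq_zero] .
  have "\<nu> 1 = \<nu> 1 + \<nu> 1" using valuation_mult[OF assms, of 1 1] by simp
  then show ?thesis by (simp add: v zero_ereal_def)
qed

lemma valuation_minus_1:
  assumes "discrete_valuation \<nu>"
  shows "\<nu> (- 1) = 0"
proof -
  obtain v where v: "\<nu> (- 1) = ereal v" using valuation_finite[OF assms, of "- 1"] by auto
  have "\<nu> 1 = \<nu> (- 1) + \<nu> (- 1)" using valuation_mult[OF assms, of "- 1" "- 1"] by simp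
  then show ?thesis by (simp add: v valuation_1[OF assms] zero_ereal_def)
qed

lemma val_ring_0: "discrete_valuation \<nu> \<Longrightarrow> 0 \<in> val_ring \<nu>"
  by (simp add: val_ring_def)

lemma val_ring_1: "discrete_valuation \<nu> \<Longrightarrow> 1 \<in> val_ring \<nu>"
  by (simp add: val_ring_def valuation_1)

lemma val_ring_mult:
  "discrete_valuation \<nu> \<Longrightarrow> x \<in> val_ring \<nu> \<Longrightarrow> y \<in> val_ring \<nu> \<Longrightarrow> x * y \<in> val_ring \<nu>"
  by (simp add: val_ring_def valuation_mult)

lemma val_ring_add:
  "discrete_valuation \<nu> \<Longrightarrow> x \<in> val_ring \<nu> \<Longrightarrow> y \<in> val_ring \<nu> \<Longrightarrow> x + y \<in> val_ring \<nu>"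
  unfolding val_ring_def discrete_valuation_def
  by (metis (no_types, lifting) mem_Collect_eq min.boundedI order_trans)

lemma val_ring_uminus:
  assumes "discrete_valuation \<nu>" "x \<in> val_ring \<nu>"
  shows "- x \<in> val_ring \<nu>"
  using valuation_mult[OF assms(1), of "- 1" x] assms
  by (simp add: val_ring_def valuation_minus_1)

lemma val_ring_diff:
  "discrete_valuation \<nu> \<Longrightarrow> x \<in> val_ring \<nu> \<Longrightarrow> y \<in> val_ring \<nu> \<Longrightarrow> x - y \<in> val_ring \<nu>"
  using val_ring_add[of \<nu> x "- y"] val_ring_uminus[of \<nu> y] by simp

lemma val_ring_sum:
  "discrete_valuation \<nu> \<Longrightarrow> (\<And>i. i \<in> A \<Longrightarrow> f i \<in> val_ring \<nu>) \<Longrightarrow> sum f A \<in> val_ring \<nu>"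
  by (induction A rule: infinite_finite_induct) (auto simp: val_ring_0 val_ring_add)

lemma val_ring_signed_iff:
  assumes "discrete_valuation \<nu>"
  shows "(- 1) ^ e * x \<in> val_ring \<nu> \<longleftrightarrow> x \<in> val_ring \<nu>"
proof (cases "even e")
  case False
  then show ?thesis
    using val_ring_uminus[OF assms, of x] val_ring_uminus[OF assms, of "- x"] by auto
qed simp

lemma divide_mem_val_ring_iff:
  assumes "discrete_valuation \<nu>" "x \<noteq> 0"
  shows "y / x \<in> val_ring \<nu> \<longleftrightarrow> \<nu> x \<le> \<nu> y"
proof -
  obtain v where v: "\<nu> x = ereal v" using valuation_finite[OF assms] .
  have "\<nu> y = \<nu> (y / x) + \<nu> x" using valuation_mult[OF assms(1), of "y / x" x] assms(2) by simp
  then show ?thesis by (cases "\<nu> (y / x)") (auto simp: val_ring_def v)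
qed

section \<open>Principal ideals of the valuation ring and their value\<close>

lemma principal_ideal_eq:
  assumes "discrete_valuation \<nu>" "g \<noteq> 0"
  shows "{g * c | c. c \<in> val_ring \<nu>} = {d. \<nu> g \<le> \<nu> d}"
proof -
  have "d \<in> {g * c | c. c \<in> val_ring \<nu>} \<longleftrightarrow> d / g \<in> val_ring \<nu>" for d
  proof
    assume "d / g \<in> val_ring \<nu>"
    moreover have "d = g * (d / g)" using assms(2) by simp
    ultimately show "d \<in> {g * c | c. c \<in> val_ring \<nu>}" by blast
  qed (use assms(2) in auto)
  then show ?thesis by (auto simp: divide_mem_val_ring_iff[OF assms])
qed

text \<open>By \<open>principal_ideal_eq\<close> the set is the ideal generated by \<open>g\<close>.
  Any other generator \<open>h\<close> satisfies \<open>\<nu> g \<le> \<nu> h\<close> as a member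
  and \<open>\<nu> h \<le> \<nu> g\<close> because it divides \<open>g\<close>, so the definite
  description in \<open>ideal_val\<close> has exactly one solution.\<close>

lemma ideal_val_upper_set:
  assumes "discrete_valuation \<nu>" "g \<noteq> 0"
  shows "ideal_val \<nu> {d. \<nu> g \<le> \<nu> d} = \<nu> g"
  unfolding ideal_val_def
proof (rule the_equality)
  show "\<exists>h\<in>{d. \<nu> g \<le> \<nu> d}. {d. \<nu> g \<le> \<nu> d} = {h * c | c. c \<in> val_ring \<nu>} \<and> \<nu> h = \<nu> g"
    using principal_ideal_eq[OF assms] by blast
next
  fix e
  assume "\<exists>h\<in>{d. \<nu> g \<le> \<nu> d}. {d. \<nu> g \<le> \<nu> d} = {h * c | c. c \<in> val_ring \<nu>} \<and> \<nu> h = e"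
  then obtain h where h: "\<nu> g \<le> \<nu> h" "{d. \<nu> g \<le> \<nu> d} = {h * c | c. c \<in> val_ring \<nu>}" "\<nu> h = e"
    by blast
  have "g \<in> {h * c | c. c \<in> val_ring \<nu>}" using h(2) by blast
  moreover from this have "h \<noteq> 0" using assms(2) by auto
  ultimately have "\<nu> h \<le> \<nu> g" using principal_ideal_eq[OF assms(1)] by blast
  then show "e = \<nu> g" using h by simp
qed

section \<open>Polynomials supported on a family of monomials\<close>

lemma eval_single_1:
  "eval (Poly_Mapping.single t 1) x = (\<Prod>i\<in>UNIV. x i ^ Poly_Mapping.lookup t i)"
  by (simp add: eval_def)

text \<open>Replaces the sum over the support by a sum over indices, to match the columns of the
  determinants; indices outside the support contribute 0.\<close>

lemma eval_eq_sum_monomials: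
  assumes "Poly_Mapping.keys f \<subseteq> t ` J" "finite J" "inj_on t J"
  shows "eval f x = (\<Sum>j\<in>J. Poly_Mapping.lookup f (t j) * eval (Poly_Mapping.single (t j) 1) x)"
proof -
  have "eval f x = (\<Sum>u\<in>t ` J. Poly_Mapping.lookup f u * eval (Poly_Mapping.single u 1) x)"
    unfolding eval_def[of f] eval_single_1
    by (rule sum.mono_neutral_left) (use assms in \<open>auto simp: in_keys_iff\<close>)
  then show ?thesis by (simp add: sum.reindex[OF assms(3)])
qed

lemma lookup_sum_single:
  assumes "finite J" "inj_on t J" "j \<in> J"
  shows "Poly_Mapping.lookup (\<Sum>i\<in>J. Poly_Mapping.single (t i) (b i)) (t j) = b j"
proof -
  have "Poly_Mapping.lookup (\<Sum>i\<in>J. Poly_Mapping.single (t i) (b i)) (t j) =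
      (\<Sum>i\<in>J. if i = j then b i else 0)"
    unfolding Poly_Mapping.lookup_sum lookup_single
    by (rule sum.cong) (use assms in \<open>auto simp: when_def inj_on_def\<close>)
  then show ?thesis using assms by simp
qed

lemma single_eq_iff:
  fixes v :: "'b::zero"
  assumes "v \<noteq> 0"
  shows "Poly_Mapping.single t v = Poly_Mapping.single u v \<longleftrightarrow> t = u"
  using assms by (metis keys_single singleton_inject)

lemma keys_sum_single:
  "Poly_Mapping.keys (\<Sum>i\<in>J. Poly_Mapping.single (t i) (b i)) \<subseteq> t ` J"
proof
  fix u
  assume "u \<in> Poly_Mapping.keys (\<Sum>i\<in>J. Poly_Mapping.single (t i) (b i))"
  then have "(\<Sum>i\<in>J. b i when t i = u) \<noteq> 0"
    by (simp add: in_keys_iff Poly_Mapping.lookup_sum lookup_single)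
  then obtain i where "i \<in> J" "(b i when t i = u) \<noteq> 0" by (meson sum.neutral)
  then show "u \<in> t ` J" by (auto simp: when_def split: if_splits)
qed

lemma lookup_const_mult:
  fixes f :: "('n::finite, 'k::field) mpoly"
  shows "Poly_Mapping.lookup (Poly_Mapping.single 0 c * f) u = c * Poly_Mapping.lookup f u"
  unfolding mult_map_scale_conv_mult[symmetric] by (simp add: map.rep_eq when_def)

lemma pdeg_le_iff:
  fixes f :: "('n::finite, 'k::field) mpoly"
  shows "pdeg f \<le> m \<longleftrightarrow> (\<forall>u\<in>Poly_Mapping.keys f. \<forall>i. Poly_Mapping.lookup u i \<le> m i)"
  by (auto simp: pdeg_def le_fun_def)

lemma tdeg_le_iff:
  fixes f :: "('n::finite, 'k::field) mpoly"
  shows "tdeg f \<le> k \<longleftrightarrow>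
    (\<forall>u\<in>Poly_Mapping.keys f. (\<Sum>i\<in>UNIV. Poly_Mapping.lookup u i) \<le> k)"
  by (auto simp: tdeg_def)

section \<open>The enumeration of the monomials\<close>

lemma down_closed_eq_lessThan_card:
  fixes J :: "nat set"
  assumes "finite J" "\<And>i j. i < j \<Longrightarrow> j \<in> J \<Longrightarrow> i \<in> J"
  shows "J = {..<card J}"
proof -
  have "i < card J" if "i \<in> J" for i
  proof -
    \<comment> \<open>The \<open>i + 1\<close> numbers up to \<open>i\<close> all lie in
      \<open>J\<close>, so \<open>i < card J\<close>; the resulting inclusion is an equality by
      counting.\<close>
    have "{..i} \<subseteq> J" using assms(2) that by (auto simp: le_less)
    then have "card {..i} \<le> card J" using assms(1) by (rule card_mono[rotated])
    then show ?thesis by simp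
  qed
  then have "J \<subseteq> {..<card J}" by auto
  then show ?thesis by (intro card_subset_eq) simp_all
qed

text \<open>
  Because the enumeration is sorted by total degree, the monomials of total degree at most \<open>k\<close> form
  an initial segment of it.
\<close>

lemma monomial_enumeration_initial_segment:
  assumes "monomial_enumeration m (p :: nat \<Rightarrow> ('n::finite, 'k::field) mpoly)"
  shows "p ` {..<card (monomials_tdeg m k :: ('n, 'k) mpoly set)} = monomials_tdeg m k"
    and "card (monomials_tdeg m k :: ('n, 'k) mpoly set)
      \<le> card (monomials m :: ('n, 'k) mpoly set)"
proof -
  let ?N = "card (monomials m :: ('n, 'k) mpoly set)"
  let ?M = "monomials_tdeg m k :: ('n, 'k) mpoly set"
  let ?J = "{j. j < ?N \<and> tdeg (p j) \<le> k}"
  have bij: "bij_betw p {..<?N} (monomials m)"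
    and mono: "\<And>i j. i < j \<Longrightarrow> j < ?N \<Longrightarrow> tdeg (p i) \<le> tdeg (p j)"
    using assms by (auto simp: monomial_enumeration_def)
  have img: "p ` ?J = ?M"
    using bij by (fastforce simp: bij_betw_def monomials_tdeg_def)
  have inj: "inj_on p ?J"
    using bij by (auto simp: bij_betw_def inj_on_def)
  have card: "card ?J = card ?M" using card_image[OF inj] img by simp
  have "?J = {..<card ?J}"
    by (rule down_closed_eq_lessThan_card) (use mono in \<open>auto intro: order_trans\<close>)
  then have J: "?J = {..<card ?M}" unfolding card .
  show "p ` {..<card ?M} = ?M" using img J by simp
  have "{..<card ?M} \<subseteq> {..<?N}" unfolding J[symmetric] by auto
  then show "card ?M \<le> ?N" by simp
qed

text \<open>Passes from monomials as polynomials to their exponent vectors \<open>t j\<close>. Both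
  degree bounds speak about each exponent of the support separately, so they amount to the support
  lying in an initial segment of \<open>t\<close>.\<close>

lemma monomial_enumeration_exponents:
  assumes "monomial_enumeration m (p :: nat \<Rightarrow> ('n::finite, 'k::field) mpoly)"
  obtains t where
    "\<And>j. j < card (monomials m :: ('n, 'k) mpoly set) \<Longrightarrow> p j = Poly_Mapping.single (t j) 1"
    "inj_on t {..<card (monomials m :: ('n, 'k) mpoly set)}"
    "\<And>f :: ('n, 'k) mpoly. pdeg f \<le> m \<and> tdeg f \<le> k \<longleftrightarrow>
       Poly_Mapping.keys f \<subseteq> t ` {..<card (monomials_tdeg m k :: ('n, 'k) mpoly set)}"
proof -
  let ?N = "card (monomials m :: ('n, 'k) mpoly set)"
  let ?L = "card (monomials_tdeg m k :: ('n, 'k) mpoly set)"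
  have bij: "bij_betw p {..<?N} (monomials m)"
    using assms by (simp add: monomial_enumeration_def)
  have "\<forall>j\<in>{..<?N}. \<exists>t. p j = Poly_Mapping.single t 1"
    using bij_betwE[OF bij] by (auto simp: monomials_def)
  then obtain t where t: "p j = Poly_Mapping.single (t j) 1" if "j < ?N" for j
    by (metis lessThan_iff)
  have inj: "inj_on t {..<?N}"
  proof (rule inj_onI)
    fix i j assume "i \<in> {..<?N}" "j \<in> {..<?N}" "t i = t j"
    then show "i = j" using t bij by (metis bij_betw_def inj_on_def lessThan_iff)
  qed
  have seg: "p ` {..<?L} = monomials_tdeg m k" "?L \<le> ?N"
    using monomial_enumeration_initial_segment[OF assms] by auto
  have mem: "(\<forall>i. Poly_Mapping.lookup u i \<le> m i) \<and> (\<Sum>i\<in>UNIV. Poly_Mapping.lookup u i) \<le> k \<longleftrightarrow>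
      u \<in> t ` {..<?L}" (is "?l \<longleftrightarrow> _") for u
  proof -
    have "?l \<longleftrightarrow> Poly_Mapping.single u (1::'k) \<in> p ` {..<?L}"
      unfolding seg(1) by (auto simp: monomials_tdeg_def monomials_def pdeg_le_iff tdeg_le_iff)
    also have "\<dots> \<longleftrightarrow> (\<exists>j<?L. Poly_Mapping.single u (1::'k) = Poly_Mapping.single (t j) 1)"
      using seg(2) t by (auto simp: image_iff Bex_def)
    also have "\<dots> \<longleftrightarrow> u \<in> t ` {..<?L}"
      by (auto simp: single_eq_iff)
    finally show ?thesis .
  qed
  show thesis
  proof
    show "pdeg f \<le> m \<and> tdeg f \<le> k \<longleftrightarrow> Poly_Mapping.keys f \<subseteq> t ` {..<?L}"
      for f :: "('n, 'k) mpoly"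
      unfolding pdeg_le_iff tdeg_le_iff using mem by blast
  qed (use t inj in auto)
qed

section \<open>The Newton basis\<close>

text \<open>The coefficient of \<open>p s\<close> in the Newton polynomial \<open>F\<^sub>r\<close>.
  The value 0 for \<open>s > r\<close> makes the array triangular and lets all
  \<open>F\<^sub>r\<close> be summed over one common range of \<open>s\<close>.\<close>

definition newton_coeff ::
  "(nat \<Rightarrow> ('n::finite, 'k::field) mpoly) \<Rightarrow> (nat \<Rightarrow> 'n \<Rightarrow> 'k) \<Rightarrow> nat \<Rightarrow> nat \<Rightarrow> 'k" where
  "newton_coeff p a r s = (if s \<le> r then (- 1) ^ (r + s) * (Delta_minor p a s r / Delta p a r) else 0)"

text \<open>Only row \<open>r\<close> contains \<open>x\<close>, so its cofactors depend on
  \<open>a 0, ..., a (r - 1)\<close> alone, and up to sign they are the minors.\<close>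

lemma Delta_upd_expansion:
  "Delta p (a(r := x)) r =
     (\<Sum>s\<le>r. (- 1) ^ (r + s) * Delta_minor p a s r * eval (p s) x)"
proof -
  let ?A = "mat (Suc r) (Suc r) (\<lambda>(i, j). eval (p j) ((a(r := x)) i))"
  have "mat_delete ?A r s = mat r r (\<lambda>(i, j). eval (p (if j < s then j else Suc j)) (a i))"
    if "s \<le> r" for s
    using that by (intro eq_matI) (auto simp: mat_delete_def)
  then have "cofactor ?A r s = (- 1) ^ (r + s) * Delta_minor p a s r" if "s \<le> r" for s
    using that by (simp add: cofactor_def Delta_minor_def)
  moreover have "det ?A = (\<Sum>s<Suc r. ?A $$ (r, s) * cofactor ?A r s)"
    by (rule laplace_expansion_row) auto
  ultimately show ?thesis
    unfolding Delta_def lessThan_Suc_atMost by (simp add: mult.commute)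
qed

lemma newton_value:
  assumes "r \<le> R"
  shows "(\<Sum>s\<le>R. newton_coeff p a r s * eval (p s) x) = Delta p (a(r := x)) r / Delta p a r"
proof -
  have "(\<Sum>s\<le>R. newton_coeff p a r s * eval (p s) x) =
      (\<Sum>s\<le>r. newton_coeff p a r s * eval (p s) x)"
    by (rule sum.mono_neutral_right) (use assms in \<open>auto simp: newton_coeff_def\<close>)
  then show ?thesis
    by (simp add: newton_coeff_def Delta_upd_expansion sum_divide_distrib)
qed

text \<open>Two rows coincide. This is the vanishing of \<open>F\<^sub>r\<close> at the points
  before \<open>a r\<close>.\<close>

lemma Delta_repeated_point:
  assumes "i < r"
  shows "Delta p (a(r := a i)) r = 0"
  unfolding Delta_def
  by (rule det_identical_rows[of _ "Suc r" i r]) (use assms in \<open>auto intro!: eq_vecI\<close>)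

lemma Delta_minor_last: "Delta_minor p a (Suc r) (Suc r) = Delta p a r"
  unfolding Delta_minor_def Delta_def by (rule arg_cong[of _ _ det]) (auto intro!: eq_matI)

text \<open>The coefficient vector lies in the kernel of the evaluation matrix, whose determinant
  \<open>Delta p a r\<close> is nonzero.\<close>

lemma coeffs_eq_0_if_vanishes:
  assumes "Delta p a r \<noteq> 0" "\<And>i. i \<le> r \<Longrightarrow> (\<Sum>s\<le>r. b s * eval (p s) (a i)) = 0" "s \<le> r"
  shows "b s = 0"
proof (rule ccontr)
  assume "b s \<noteq> 0"
  let ?A = "mat (Suc r) (Suc r) (\<lambda>(i, j). eval (p j) (a i))"
  have "vec (Suc r) b \<noteq> 0\<^sub>v (Suc r)"
    using \<open>b s \<noteq> 0\<close> assms(3) by (metis index_vec index_zero_vec(1) le_imp_less_Suc)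
  moreover have "?A *\<^sub>v vec (Suc r) b = 0\<^sub>v (Suc r)"
    using assms(2)
    by (intro eq_vecI)
       (auto simp: scalar_prod_def atLeast0LessThan lessThan_Suc_atMost mult.commute)
  ultimately have "det ?A = 0"
    by (subst det_0_iff_vec_prod_zero_field[of _ "Suc r"]) (auto intro!: exI[of _ "vec (Suc r) b"])
  then show False using assms(1) by (simp add: Delta_def)
qed

text \<open>The system is triangular with unit diagonal, so each unknown is found from the earlier
  ones without division and stays in the valuation ring.\<close>

lemma forward_substitution:
  fixes T :: "nat \<Rightarrow> nat \<Rightarrow> 'k::field"
  assumes "discrete_valuation \<nu>"
    and "\<And>q. T q q = 1"
    and "\<And>q i. i \<le> r \<Longrightarrow> q \<le> i \<Longrightarrow> T q i \<in> val_ring \<nu>"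
    and "\<And>i. i \<le> r \<Longrightarrow> v i \<in> val_ring \<nu>"
  shows "\<exists>c. (\<forall>i\<le>r. c i \<in> val_ring \<nu>) \<and> (\<forall>i\<le>r. (\<Sum>q\<le>i. c q * T q i) = v i)"
  using assms(3,4)
proof (induction r)
  case 0
  then show ?case by (intro exI[of _ v]) (simp add: assms(2))
next
  case (Suc r)
  then obtain c where c: "\<And>i. i \<le> r \<Longrightarrow> c i \<in> val_ring \<nu>"
      "\<And>i. i \<le> r \<Longrightarrow> (\<Sum>q\<le>i. c q * T q i) = v i"
    by (metis le_SucI)
  \<comment> \<open>The value that equation \<open>Suc r\<close> forces on the new unknown.\<close>
  define w where "w = v (Suc r) - (\<Sum>q\<le>r. c q * T q (Suc r))"
  have "w \<in> val_ring \<nu>"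
    unfolding w_def using c(1) Suc.prems
    by (intro val_ring_diff val_ring_sum val_ring_mult assms(1)) auto
  moreover have "(\<Sum>q\<le>i. (c(Suc r := w)) q * T q i) = (\<Sum>q\<le>i. c q * T q i)" if "i \<le> r" for i
    by (rule sum.cong) (use that in auto)
  moreover have "(\<Sum>q\<le>Suc r. (c(Suc r := w)) q * T q (Suc r)) = v (Suc r)"
    by (simp add: w_def assms(2))
  ultimately show ?case
    using c by (intro exI[of _ "c(Suc r := w)"]) (auto simp: le_Suc_eq)
qed

text \<open>The \<open>c q\<close> are chosen so that the expansion takes the right values at
  \<open>a 0, ..., a r\<close>; the system is triangular since \<open>F\<^sub>q\<close> vanishes
  before \<open>a q\<close> and is 1 there. Agreement at these points then forces equality of
  coefficients by \<open>coeffs_eq_0_if_vanishes\<close>.\<close>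

lemma newton_expansion:
  assumes val: "discrete_valuation \<nu>"
    and nz: "\<And>q. q \<le> r \<Longrightarrow> Delta p a q \<noteq> 0"
    and int: "\<And>q i. q \<le> r \<Longrightarrow> i \<le> r \<Longrightarrow> Delta p (a(q := a i)) q / Delta p a q \<in> val_ring \<nu>"
    and b: "\<And>i. i \<le> r \<Longrightarrow> (\<Sum>s\<le>r. b s * eval (p s) (a i)) \<in> val_ring \<nu>"
  shows "\<exists>c. (\<forall>q\<le>r. c q \<in> val_ring \<nu>) \<and> (\<forall>s\<le>r. b s = (\<Sum>q\<le>r. c q * newton_coeff p a q s))"
proof -
  \<comment> \<open>\<open>T q i\<close> is the value of \<open>F\<^sub>q\<close> at
    \<open>a i\<close>. The diagonal is set to 1 by hand because \<open>forward_substitution\<close>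
    asks for it at every \<open>q\<close>, while for \<open>q > r\<close> the quotient could be
    \<open>0 / 0 = 0\<close>.\<close>
  define T where "T q i = (if q = i then 1 else Delta p (a(q := a i)) q / Delta p a q)" for q i
  have T: "T q i = Delta p (a(q := a i)) q / Delta p a q" if "q \<le> r" for q i
    using nz[OF that] by (cases "q = i") (simp_all add: T_def)
  have "\<exists>c. (\<forall>i\<le>r. c i \<in> val_ring \<nu>) \<and>
      (\<forall>i\<le>r. (\<Sum>q\<le>i. c q * T q i) = (\<Sum>s\<le>r. b s * eval (p s) (a i)))"
    by (rule forward_substitution[OF val]) (use int b T in \<open>auto simp: T_def val_ring_1[OF val]\<close>)
  then obtain c where c: "\<And>i. i \<le> r \<Longrightarrow> c i \<in> val_ring \<nu>"
    "\<And>i. i \<le> r \<Longrightarrow> (\<Sum>q\<le>i. c q * T q i) = (\<Sum>s\<le>r. b s * eval (p s) (a i))" by blast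
  have "b s - (\<Sum>q\<le>r. c q * newton_coeff p a q s) = 0" if "s \<le> r" for s
  proof (rule coeffs_eq_0_if_vanishes[OF nz[OF order_refl] _ that,
        where b = "\<lambda>s. b s - (\<Sum>q\<le>r. c q * newton_coeff p a q s)"])
    fix i assume i: "i \<le> r"
    have "(\<Sum>s\<le>r. (\<Sum>q\<le>r. c q * newton_coeff p a q s) * eval (p s) (a i)) =
        (\<Sum>q\<le>r. c q * (\<Sum>s\<le>r. newton_coeff p a q s * eval (p s) (a i)))"
      unfolding sum_distrib_left sum_distrib_right
      by (subst sum.swap) (simp add: mult.assoc)
    also have "\<dots> = (\<Sum>q\<le>r. c q * T q i)"
      by (simp add: newton_value T)
    also have "\<dots> = (\<Sum>q\<le>i. c q * T q i)"
      by (rule sum.mono_neutral_right) (use i in \<open>auto simp: T Delta_repeated_point\<close>)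
    also have "\<dots> = (\<Sum>s\<le>r. b s * eval (p s) (a i))" using c(2) i by simp
    finally show "(\<Sum>s\<le>r. (b s - (\<Sum>q\<le>r. c q * newton_coeff p a q s)) * eval (p s) (a i)) = 0"
      by (simp add: left_diff_distrib sum_subtractf)
  qed
  then show ?thesis using c(1) by (intro exI[of _ c]) auto
qed

section \<open>Consequences of the ordering condition\<close>

text \<open>Induction on \<open>r\<close>. If the next determinant were 0, the infimum defining the
  ordering would be \<open>\<infinity>\<close>, so the polynomial \<open>f\<close> obtained by
  letting the last point vary would vanish on \<open>S\<close> and hence be 0.\<close>

lemma Delta_nonzero:
  assumes val: "discrete_valuation \<nu>"
    and enum: "monomial_enumeration m (p :: nat \<Rightarrow> ('n::finite, 'k::field) mpoly)"
    and van: "vanishing_ideal S = {0}"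
    and ord: "nu_ordering \<nu> m p S a"
    and "r < card (monomials m :: ('n, 'k) mpoly set)"
  shows "Delta p a r \<noteq> 0"
  using assms(5)
proof (induction r)
  case 0
  have "p 0 = Poly_Mapping.single 0 1" using enum by (simp add: monomial_enumeration_def)
  then have "eval (p 0) (a 0) = 1" by (simp only: eval_single_1) simp
  then show ?case by (simp add: Delta_def det_single)
next
  case (Suc r)
  let ?N = "card (monomials m :: ('n, 'k) mpoly set)"
  obtain t where t: "\<And>j. j < ?N \<Longrightarrow> p j = Poly_Mapping.single (t j) 1" "inj_on t {..<?N}"
    using monomial_enumeration_exponents[OF enum] by metis
  have inj: "inj_on t {..Suc r}" using t(2) Suc.prems by (auto simp: inj_on_def)
  define b where "b s = (- 1) ^ (Suc r + s) * Delta_minor p a s (Suc r)" for s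
  define f where "f = (\<Sum>s\<le>Suc r. Poly_Mapping.single (t s) (b s))"
  have look: "Poly_Mapping.lookup f (t s) = b s" if "s \<le> Suc r" for s
    unfolding f_def using that inj by (intro lookup_sum_single) auto
  have ev: "eval f x = Delta p (a(Suc r := x)) (Suc r)" for x
  proof -
    have "eval f x = (\<Sum>s\<le>Suc r. Poly_Mapping.lookup f (t s) * eval (Poly_Mapping.single (t s) 1) x)"
      unfolding f_def by (rule eval_eq_sum_monomials[OF keys_sum_single _ inj]) auto
    also have "\<dots> = (\<Sum>s\<le>Suc r. b s * eval (p s) x)"
      by (rule sum.cong) (use Suc.prems in \<open>auto simp: look t(1)\<close>)
    finally show ?thesis unfolding Delta_upd_expansion b_def .
  qed
  show ?case
  proof
    assume "Delta p a (Suc r) = 0"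
    then have "(INF x\<in>S. \<nu> (Delta p (a(Suc r := x)) (Suc r))) = \<infinity>"
      using ord Suc.prems val unfolding nu_ordering_def
      by (metis One_nat_def Suc_le_mono valuation_0 zero_le)
    then have "\<nu> (eval f x) = \<infinity>" if "x \<in> S" for x
      using INF_lower[OF that, of "\<lambda>x. \<nu> (Delta p (a(Suc r := x)) (Suc r))"] by (simp add: ev)
    then have "f \<in> vanishing_ideal S"
      using val by (auto simp: vanishing_ideal_def discrete_valuation_def)
    \<comment> \<open>The coefficient of \<open>f\<close> at the last monomial is
      \<open>Delta p a r\<close>, nonzero by the induction hypothesis.\<close>
    then have "b (Suc r) = 0" using van look by auto
    then show False using Suc by (simp add: b_def Delta_minor_last)
  qed
qed

lemma newton_integral_on:
  assumes val: "discrete_valuation \<nu>"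
    and nz: "Delta p a r \<noteq> 0"
    and ord: "nu_ordering \<nu> m (p :: nat \<Rightarrow> ('n::finite, 'k::field) mpoly) S a"
    and "r < card (monomials m :: ('n, 'k) mpoly set)" "x \<in> S" "p 0 = 1"
  shows "Delta p (a(r := x)) r / Delta p a r \<in> val_ring \<nu>"
proof (cases "r = 0")
  \<comment> \<open>The ordering condition starts at \<open>r = 1\<close>; for \<open>r = 0\<close>
    both determinants are 1 because \<open>p 0 = 1\<close>.\<close>
  case True
  have "p 0 = Poly_Mapping.single 0 1" using assms(6) by simp
  then have "eval (p 0) y = 1" for y by (simp only: eval_single_1) simp
  then show ?thesis using True by (simp add: Delta_def det_single val_ring_1[OF val])
next
  case False
  then have "\<nu> (Delta p a r) = (INF x\<in>S. \<nu> (Delta p (a(r := x)) r))"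
    using ord assms(4) by (auto simp: nu_ordering_def)
  then have "\<nu> (Delta p a r) \<le> \<nu> (Delta p (a(r := x)) r)"
    using INF_lower[OF assms(5)] by metis
  then show ?thesis using divide_mem_val_ring_iff[OF val nz] by blast
qed

section \<open>The ideal of common denominators\<close>

text \<open>Each \<open>F\<^sub>r\<close> with \<open>r\<close> below the number of admissible
  monomials is itself in \<open>Int_poly\<close>, which gives one inclusion. Conversely,
  \<open>newton_expansion\<close> writes any member of \<open>Int_poly\<close> as an integral
  combination of these \<open>F\<^sub>r\<close>.\<close>

lemma Gamma_ideal_eq:
  assumes val: "discrete_valuation \<nu>"
    and enum: "monomial_enumeration m (p :: nat \<Rightarrow> ('n::finite, 'k::field) mpoly)"
    and van: "vanishing_ideal S = {0}"
    and ord: "nu_ordering \<nu> m p S a"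
  shows "Gamma_ideal \<nu> m k S = {d \<in> val_ring \<nu>.
    \<forall>r < card (monomials_tdeg m k :: ('n, 'k) mpoly set). \<forall>s\<le>r. d * newton_coeff p a r s \<in> val_ring \<nu>}"
    (is "_ = ?R")
proof -
  let ?N = "card (monomials m :: ('n, 'k) mpoly set)"
  let ?L = "card (monomials_tdeg m k :: ('n, 'k) mpoly set)"
  obtain t where t: "\<And>j. j < ?N \<Longrightarrow> p j = Poly_Mapping.single (t j) 1" "inj_on t {..<?N}"
    and keys: "\<And>f :: ('n, 'k) mpoly. pdeg f \<le> m \<and> tdeg f \<le> k \<longleftrightarrow> Poly_Mapping.keys f \<subseteq> t ` {..<?L}"
    using monomial_enumeration_exponents[OF enum, where k = k] by metis
  have LN: "?L \<le> ?N" using monomial_enumeration_initial_segment[OF enum] by auto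
  have p0: "p 0 = 1" using enum by (simp add: monomial_enumeration_def)
  have nz: "Delta p a r \<noteq> 0" if "r < ?L" for r
    using Delta_nonzero[OF val enum van ord] that LN by simp
  have inS: "a i \<in> S" if "i < ?L" for i
    using ord that LN by (simp add: nu_ordering_def)
  have int: "Delta p (a(r := x)) r / Delta p a r \<in> val_ring \<nu>" if "r < ?L" "x \<in> S" for r x
    using newton_integral_on[OF val nz ord _ _ p0] that LN by simp
  have ev: "eval f x = (\<Sum>j\<le>r. Poly_Mapping.lookup f (t j) * eval (p j) x)"
    if "Poly_Mapping.keys f \<subseteq> t ` {..r}" "r < ?L" for f x r
  proof -
    have "inj_on t {..r}" using t(2) that LN by (auto simp: inj_on_def)
    then show ?thesis
      using eval_eq_sum_monomials[OF that(1), of x] t(1) that(2) LN by simp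
  qed
  show ?thesis
  proof (intro equalityI subsetI)
    fix d assume d: "d \<in> Gamma_ideal \<nu> m k S"
    have "d * newton_coeff p a r s \<in> val_ring \<nu>" if r: "r < ?L" and s: "s \<le> r" for r s
    proof -
      define f where "f = (\<Sum>j\<le>r. Poly_Mapping.single (t j) (newton_coeff p a r j))"
      have inj: "inj_on t {..r}" using t(2) r LN by (auto simp: inj_on_def)
      have look: "Poly_Mapping.lookup f (t j) = newton_coeff p a r j" if "j \<le> r" for j
        unfolding f_def using that inj by (intro lookup_sum_single) auto
      have kf: "Poly_Mapping.keys f \<subseteq> t ` {..r}" unfolding f_def by (rule keys_sum_single)
      have "eval f x = Delta p (a(r := x)) r / Delta p a r" for x
        using ev[OF kf r] look newton_value[OF order_refl] by simp
      then have "f \<in> Int_poly \<nu> m k S"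
        using int[OF r] keys[of f] kf r by (force simp: Int_poly_def)
      then have "Poly_Mapping.single 0 d * f \<in> val_ring_polys \<nu>"
        using d by (auto simp: Gamma_ideal_def)
      then have "d * Poly_Mapping.lookup f (t s) \<in> val_ring \<nu>"
        by (simp add: val_ring_polys_def lookup_const_mult)
      then show ?thesis using look s by simp
    qed
    then show "d \<in> ?R" using d by (auto simp: Gamma_ideal_def)
  next
    fix d assume d: "d \<in> ?R"
    have "Poly_Mapping.single 0 d * f \<in> val_ring_polys \<nu>" if f: "f \<in> Int_poly \<nu> m k S" for f
    proof -
      have "d * Poly_Mapping.lookup f u \<in> val_ring \<nu>" for u
      proof (cases "u \<in> Poly_Mapping.keys f")
        case True
        have kf: "Poly_Mapping.keys f \<subseteq> t ` {..<?L}" using f keys by (simp add: Int_poly_def)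
        \<comment> \<open>The index \<open>j\<close> also shows that \<open>?L\<close> is positive,
          so that \<open>?L - 1\<close> is a genuine last index.\<close>
        with True obtain j where j: "j < ?L" "u = t j" by auto
        define r where "r = ?L - 1"
        have r: "r < ?L" "{..<?L} = {..r}" "j \<le> r" using j by (auto simp: r_def)
        have "\<exists>c. (\<forall>q\<le>r. c q \<in> val_ring \<nu>) \<and>
            (\<forall>s\<le>r. Poly_Mapping.lookup f (t s) = (\<Sum>q\<le>r. c q * newton_coeff p a q s))"
        proof (rule newton_expansion[OF val])
          fix i assume "i \<le> r"
          then have "eval f (a i) \<in> val_ring \<nu>" using f inS r(1) by (auto simp: Int_poly_def)
          then show "(\<Sum>s\<le>r. Poly_Mapping.lookup f (t s) * eval (p s) (a i)) \<in> val_ring \<nu>"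
            using ev kf r by simp
        qed (use nz int inS r(1) in auto)
        then obtain c where c: "\<And>q. q \<le> r \<Longrightarrow> c q \<in> val_ring \<nu>"
          "Poly_Mapping.lookup f u = (\<Sum>q\<le>r. c q * newton_coeff p a q j)" using j r by blast
        \<comment> \<open>The hypothesis on \<open>d\<close> covers \<open>j \<le> q\<close>; for
          \<open>j > q\<close> the coefficient is 0 by definition.\<close>
        have "c q * (d * newton_coeff p a q j) \<in> val_ring \<nu>" if "q \<le> r" for q
        proof (cases "j \<le> q")
          case True
          then have "d * newton_coeff p a q j \<in> val_ring \<nu>" using d that r(1) by auto
          then show ?thesis using c(1)[OF that] val_ring_mult[OF val] by blast
        qed (simp add: newton_coeff_def val_ring_0[OF val])
        then show ?thesis
          unfolding c(2) sum_distrib_left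
          by (intro val_ring_sum[OF val]) (simp add: mult.left_commute)
      qed (simp add: in_keys_iff val_ring_0[OF val])
      then show ?thesis by (simp add: val_ring_polys_def lookup_const_mult)
    qed
    then show "d \<in> Gamma_ideal \<nu> m k S" using d by (auto simp: Gamma_ideal_def)
  qed
qed

theorem corollary3p5:
  fixes \<nu> :: "'k::field \<Rightarrow> ereal"
    and m :: "'n::finite \<Rightarrow> nat"
    and k :: nat
    and p :: "nat \<Rightarrow> ('n, 'k) mpoly"
    and S :: "('n \<Rightarrow> 'k) set"
    and a :: "nat \<Rightarrow> 'n \<Rightarrow> 'k"
  assumes "discrete_valuation \<nu>"
    and "monomial_enumeration m p"
    and "S \<subseteq> {x. \<forall>i. x i \<in> val_ring \<nu>}"
    and "vanishing_ideal S = {0}"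
    and "nu_ordering \<nu> m p S a"
  shows "ideal_val \<nu> (Gamma_ideal \<nu> m k S) =
    Max ((\<lambda>(r, s). \<nu> (Delta p a r / Delta_minor p a s r)) `
      {(r, s). r < card (monomials_tdeg m k :: ('n, 'k) mpoly set) \<and> s \<le> r \<and>
               Delta_minor p a s r \<noteq> 0})"
proof -
  note val = assms(1) and enum = assms(2)
  let ?L = "card (monomials_tdeg m k :: ('n, 'k) mpoly set)"
  let ?I = "{(r, s). r < ?L \<and> s \<le> r \<and> Delta_minor p a s r \<noteq> 0}"
  let ?g = "\<lambda>(r, s). Delta p a r / Delta_minor p a s r"
  have LN: "?L \<le> card (monomials m :: ('n, 'k) mpoly set)"
    using monomial_enumeration_initial_segment[OF enum] by auto
  have nz: "Delta p a r \<noteq> 0" if "r < ?L" for r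
    using Delta_nonzero[OF val enum assms(4,5)] that LN by simp
  have p0: "p 0 = Poly_Mapping.single 0 1"
    using enum by (simp add: monomial_enumeration_def)
  \<comment> \<open>The constant monomial meets every degree bound, so the pair
    \<open>(0, 0)\<close> is available and the maximum is over a nonempty set.\<close>
  have "p 0 \<in> monomials_tdeg m k"
    unfolding p0 monomials_tdeg_def monomials_def pdeg_le_iff tdeg_le_iff
    by (auto intro!: exI[of _ 0])
  then have L: "0 < ?L"
    using monomial_enumeration_initial_segment(1)[OF enum, of k] by force
  have minor0: "Delta_minor p a 0 0 = 1" by (simp add: Delta_minor_def)
  have Delta0: "Delta p a 0 = 1" 
    by (simp add: Delta_def det_single p0 eval_single_1 del: single_one)
  have fin: "finite ?I"
    by (rule finite_subset[of _ "{..<?L} \<times> {..<?L}"]) auto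
  have ne: "(0, 0) \<in> ?I" using L minor0 by simp
  define M where "M = Max ((\<lambda>z. \<nu> (?g z)) ` ?I)"
  have "M \<in> (\<lambda>z. \<nu> (?g z)) ` ?I"
    unfolding M_def using fin ne by (intro Max_in) auto
  \<comment> \<open>The maximum is attained, so \<open>M\<close> is the value of one of the
    quotients, nonzero because \<open>Delta p a r\<close> is; it will generate the ideal.\<close>
  then obtain g where g: "M = \<nu> g" "g \<noteq> 0" using nz by auto
  have M_le: "M \<le> e \<longleftrightarrow> (\<forall>z\<in>?I. \<nu> (?g z) \<le> e)" for e
    unfolding M_def using fin ne by (subst Max_le_iff) auto
  \<comment> \<open>Up to sign a Newton coefficient is either 0 or the inverse of the quotient
    \<open>?g (r, s)\<close>. A zero minor thus puts no condition on \<open>d\<close>, which is why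
    such pairs are disregarded.\<close>
  have "d * newton_coeff p a r s \<in> val_ring \<nu> \<longleftrightarrow>
      Delta_minor p a s r = 0 \<or> \<nu> (?g (r, s)) \<le> \<nu> d" if "r < ?L" "s \<le> r" for d r s
  proof (cases "Delta_minor p a s r = 0")
    case False
    have "d * newton_coeff p a r s = (- 1) ^ (r + s) * (d / ?g (r, s))"
      using that by (simp add: newton_coeff_def)
    moreover have "?g (r, s) \<noteq> 0" using False nz[OF that(1)] by simp
    ultimately show ?thesis
      using False by (simp only: val_ring_signed_iff[OF val] divide_mem_val_ring_iff[OF val] simp_thms)
  qed (simp add: newton_coeff_def val_ring_0[OF val])
  then have "Gamma_ideal \<nu> m k S = {d \<in> val_ring \<nu>. M \<le> \<nu> d}"
    unfolding Gamma_ideal_eq[OF val enum assms(4,5)] M_le by auto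
  also have "\<dots> = {d. \<nu> g \<le> \<nu> d}"
  proof -
    \<comment> \<open>The quotient at \<open>(0, 0)\<close> is 1, so \<open>M \<ge> 0\<close> and
      the bound by \<open>M\<close> already implies integrality.\<close>
    have "d \<in> val_ring \<nu>" if "M \<le> \<nu> d" for d
    proof -
      have "\<nu> (?g (0, 0)) \<le> \<nu> d" using M_le ne that by blast
      then show ?thesis by (simp add: minor0 Delta0 valuation_1[OF val] val_ring_def)
    qed
    then show ?thesis using g(1) by auto
  qed
  finally have "ideal_val \<nu> (Gamma_ideal \<nu> m k S) = M"
    using ideal_val_upper_set[OF val g(2)] g(1) by simp
  then show ?thesis by (simp add: M_def case_prod_unfold)
qed

end
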